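(* Let $\Delta$ be a simplicial tree with the intersection property and $\dim(\Delta)\ge 1$. Then $\nu(\Delta)\le 2$.
   Context: A simplicial complex $\Delta$ on a finite vertex set is a non-empty collection of subsets (faces) closed under taking subsets; its facets are the inclusion-maximal faces, and $\mathcal F(\Delta)$ is the set of facets. The dimension of a face $F$ is $|F|-1$ (so $\dim\emptyset=-1$), $\dim\Delta$ is the maximum dimension of a face, and $\Delta$ is pure if all facets have the same dimension. A subcollection of $\Delta$ is a simplicial complex $\Delta'$ with $\mathcal F(\Delta')\subseteq\mathcal F(\Delta)$. A facet $F$ of $\Delta$ is a leaf if either $F$ is the only facet of $\Delta$ or there is a facet $G\neq F$ of $\Delta$ with $H\cap F\subseteq G\cap F$ for all facets $H\ne F$ of $\Delta$. A connected simplicial complex is a simplicial tree if every nonempty subcollection of it has a leaf. A matching of $\Delta$ is a set of pairwise disjoint facets; $\nu(\Delta)$ is the maximum size of a matching. $\Delta$ is connected in codimension 1 if for any two facets $F,G$ with $\dim F\ge\dim G$ there is a chain of facets $F=F_0,\ldots,F_n=G$ with $\dim(F_i\cap F_{i+1})=\dim(F_{i+1})-1$ for all $i=0,\dots,n-1$; such a chain is called a proper chain between $F$ and $G$ (of length $n$). A proper chain is irredundant if no subsequence of it other than itself is a proper chain between $F$ and $G$. In a pure $d$-dimensional simplicial tree connected in codimension 1, there is a unique irredundant proper chain between any two facets $F,G$ (a known result); its length is denoted $\mathrm{dist}(F,G)$. Such a $\Delta$ (pure $d$-dimensional simplicial tree connected in codimension 1) has the intersection property if for any two facets $F,G$ with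 $\dim(F\cap G)=d-k$ for some $k\in\{1,\ldots,d+1\}$ one has $\mathrm{dist}(F,G)=k$. *)

theory Defs
  imports Main "HOL-Library.Sublist"
begin

definition simplicial_complex :: "'a set set \<Rightarrow> bool" where
  "simplicial_complex \<Delta> \<longleftrightarrow>
     finite (\<Union>\<Delta>) \<and> \<Delta> \<noteq> {} \<and> (\<forall>F\<in>\<Delta>. \<forall>G. G \<subseteq> F \<longrightarrow> G \<in> \<Delta>)"

definition facets :: "'a set set \<Rightarrow> 'a set set" where
  "facets \<Delta> = {F \<in> \<Delta>. \<forall>G\<in>\<Delta>. F \<subseteq> G \<longrightarrow> G = F}"

definition face_dim :: "'a set \<Rightarrow> int" where
  "face_dim F = int (card F) - 1"

definition complex_dim :: "'a set set \<Rightarrow> int" where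
  "complex_dim \<Delta> = Max (face_dim ` \<Delta>)"

definition pure_complex :: "'a set set \<Rightarrow> bool" where
  "pure_complex \<Delta> \<longleftrightarrow> (\<forall>F\<in>facets \<Delta>. \<forall>G\<in>facets \<Delta>. face_dim F = face_dim G)"

definition subcollection :: "'a set set \<Rightarrow> 'a set set \<Rightarrow> bool" where
  "subcollection \<Gamma> \<Delta> \<longleftrightarrow> simplicial_complex \<Gamma> \<and> facets \<Gamma> \<subseteq> facets \<Delta>"

definition leaf :: "'a set set \<Rightarrow> 'a set \<Rightarrow> bool" where
  "leaf \<Delta> F \<longleftrightarrow> F \<in> facets \<Delta> \<and>
     (facets \<Delta> = {F} \<or>
      (\<exists>G\<in>facets \<Delta>. G \<noteq> F \<and> (\<forall>H\<in>facets \<Delta>. H \<noteq> F \<longrightarrow> H \<inter> F \<subseteq> G \<inter> F)))"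

text \<open>Connectedness in the usual sense for facet complexes: any two facets are joined by a
  sequence of facets in which consecutive members meet.\<close>

definition connected_complex :: "'a set set \<Rightarrow> bool" where
  "connected_complex \<Delta> \<longleftrightarrow>
     (\<forall>F\<in>facets \<Delta>. \<forall>G\<in>facets \<Delta>. \<exists>ch. ch \<noteq> [] \<and> set ch \<subseteq> facets \<Delta> \<and>
        hd ch = F \<and> last ch = G \<and> successively (\<lambda>A B. A \<inter> B \<noteq> {}) ch)"

text \<open>A subcollection is a simplicial complex and hence a non-empty collection, so
  ``every non-empty subcollection'' needs no further restriction.\<close>

definition simplicial_tree :: "'a set set \<Rightarrow> bool" where
  "simplicial_tree \<Delta> \<longleftrightarrow> simplicial_complex \<Delta> \<and> connected_complex \<Delta> \<and>
     (\<forall>\<Gamma>. subcollection \<Gamma> \<Delta> \<longrightarrow> (\<exists>F. leaf \<Gamma> F))"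

definition matching :: "'a set set \<Rightarrow> 'a set set \<Rightarrow> bool" where
  "matching \<Delta> M \<longleftrightarrow> M \<subseteq> facets \<Delta> \<and> pairwise disjnt M"

definition matching_number :: "'a set set \<Rightarrow> nat" where
  "matching_number \<Delta> = Max (card ` {M. matching \<Delta> M})"

text \<open>A chain \<open>F\<^sub>0, \<dots>, F\<^sub>n\<close> is the list of its members; its length is \<open>n\<close>, one less than the
  length of the list.\<close>

definition proper_chain :: "'a set set \<Rightarrow> 'a set \<Rightarrow> 'a set \<Rightarrow> 'a set list \<Rightarrow> bool" where
  "proper_chain \<Delta> F G ch \<longleftrightarrow> ch \<noteq> [] \<and> set ch \<subseteq> facets \<Delta> \<and> hd ch = F \<and> last ch = G \<and>
     successively (\<lambda>A B. face_dim (A \<inter> B) = face_dim B - 1) ch"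

definition connected_in_codim_1 :: "'a set set \<Rightarrow> bool" where
  "connected_in_codim_1 \<Delta> \<longleftrightarrow>
     (\<forall>F\<in>facets \<Delta>. \<forall>G\<in>facets \<Delta>. face_dim F \<ge> face_dim G \<longrightarrow> (\<exists>ch. proper_chain \<Delta> F G ch))"

definition irredundant_proper_chain ::
    "'a set set \<Rightarrow> 'a set \<Rightarrow> 'a set \<Rightarrow> 'a set list \<Rightarrow> bool" where
  "irredundant_proper_chain \<Delta> F G ch \<longleftrightarrow> proper_chain \<Delta> F G ch \<and>
     (\<forall>ch'. subseq ch' ch \<and> proper_chain \<Delta> F G ch' \<longrightarrow> ch' = ch)"

text \<open>Meaningful for pure simplicial trees connected in codimension 1, where the irredundant
  proper chain between two facets is unique.\<close>

definition facet_dist :: "'a set set \<Rightarrow> 'a set \<Rightarrow> 'a set \<Rightarrow> nat" where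
  "facet_dist \<Delta> F G = length (THE ch. irredundant_proper_chain \<Delta> F G ch) - 1"

definition intersection_property :: "'a set set \<Rightarrow> bool" where
  "intersection_property \<Delta> \<longleftrightarrow>
     simplicial_tree \<Delta> \<and> pure_complex \<Delta> \<and> connected_in_codim_1 \<Delta> \<and>
     (\<forall>F\<in>facets \<Delta>. \<forall>G\<in>facets \<Delta>. \<forall>k\<in>{1..complex_dim \<Delta> + 1}.
        face_dim (F \<inter> G) = complex_dim \<Delta> - k \<longrightarrow> int (facet_dist \<Delta> F G) = k)"

end

theory Submission
  imports Defs
begin

text \<open>
  Write \<open>n = d + 1 \<ge> 2\<close> for the common size of the facets, and call two facets adjacent if they meet
  in \<open>n - 1\<close> vertices. Suppose that \<open>A\<close>, \<open>B\<close>, \<open>C\<close> are pairwise disjoint facets. The intersection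
  property makes the irredundant proper chain between any two of them have length exactly \<open>n\<close>.
  Each step of a proper chain brings in only one new vertex, so the chain from \<open>A\<close> to \<open>B\<close> uses at
  most \<open>2n\<close> vertices; as \<open>A \<union> B\<close> already has \<open>2n\<close>, every member of the chain lies in \<open>A \<union> B\<close>.
  Now concatenate the chains from \<open>A\<close> to \<open>C\<close> and from \<open>C\<close> to \<open>B\<close> and thin the result out until it
  is irredundant. By uniqueness this gives the chain from \<open>A\<close> to \<open>B\<close> again, so each of its members
  also lies in \<open>A \<union> C\<close> or in \<open>B \<union> C\<close>, hence in \<open>A\<close> or in \<open>B\<close>, and is therefore \<open>A\<close> or \<open>B\<close>
  itself. But a chain of length \<open>n \<ge> 2\<close> has a member other than its ends.

  The definition of the distance presupposes that irredundant proper chains are unique, and this is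
  the larger part of the work. An irredundant proper chain is an induced path of the adjacency graph,
  so it is enough that this graph is a block graph, that is, chordal without induced diamonds. Both
  facts come from the leaf condition applied to arbitrary sets of facets. All ridges in which a leaf
  meets its neighbours coincide, so a leaf is a simplicial vertex; the simplicial vertices of all
  induced subgraphs are what chordality provides (\<open>leaf_simplicial\<close>). Applied to three mutually
  adjacent facets, the leaf condition shows that they share one ridge (\<open>triangle_common_ridge\<close>),
  which excludes induced diamonds. That induced paths in such a graph are unique
  (\<open>induced_path_unique\<close>) is proved by deleting one simplicial vertex at a time.
\<close>

section \<open>Induced paths in chordal graphs without induced diamonds\<close>

definition path_between :: "('a \<Rightarrow> 'a \<Rightarrow> bool) \<Rightarrow> 'a set \<Rightarrow> 'a \<Rightarrow> 'a \<Rightarrow> 'a list \<Rightarrow> bool" where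
  "path_between R S f g p \<longleftrightarrow>
     p \<noteq> [] \<and> set p \<subseteq> S \<and> hd p = f \<and> last p = g \<and> successively R p"

text \<open>Chords are excluded through decompositions of the list instead of indices, since then reversing
  the list and passing to a factor are immediate. For the members of an actual path this is
  inducedness in the usual sense when \<open>R\<close> is symmetric there.\<close>

definition induced_list :: "('a \<Rightarrow> 'a \<Rightarrow> bool) \<Rightarrow> 'a list \<Rightarrow> bool" where
  "induced_list R p \<longleftrightarrow>
     distinct p \<and> (\<forall>us x vs y ws. p = us @ x # vs @ y # ws \<and> R x y \<longrightarrow> vs = [])"

definition simplicial_vertex :: "('a \<Rightarrow> 'a \<Rightarrow> bool) \<Rightarrow> 'a set \<Rightarrow> 'a \<Rightarrow> bool" where
  "simplicial_vertex R T v \<longleftrightarrow>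
     v \<in> T \<and> (\<forall>x\<in>T. \<forall>y\<in>T. R v x \<and> R v y \<and> x \<noteq> y \<longrightarrow> R x y)"

lemma induced_list_factor:
  assumes "induced_list R (us @ p @ ws)"
  shows "induced_list R p"
  unfolding induced_list_def
proof (intro conjI allI impI)
  show "distinct p" using assms by (auto simp: induced_list_def)
  fix as x vs y bs assume "p = as @ x # vs @ y # bs \<and> R x y"
  then have "us @ p @ ws = (us @ as) @ x # vs @ y # (bs @ ws)" "R x y" by auto
  then show "vs = []" using assms unfolding induced_list_def by blast
qed

lemma induced_list_rev:
  assumes "induced_list R p" and sym: "\<And>x y. x \<in> set p \<Longrightarrow> y \<in> set p \<Longrightarrow> R x y \<Longrightarrow> R y x"
  shows "induced_list R (rev p)"
  unfolding induced_list_def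
proof (intro conjI allI impI)
  show "distinct (rev p)" using assms by (auto simp: induced_list_def)
  fix as x vs y bs assume a: "rev p = as @ x # vs @ y # bs \<and> R x y"
  then have "rev (rev p) = rev (as @ x # vs @ y # bs)" by simp
  then have p: "p = rev bs @ y # rev vs @ x # rev as" by simp
  with a sym have "R y x" by auto
  with p assms(1) have "rev vs = []" unfolding induced_list_def by blast
  then show "vs = []" by simp
qed

lemma induced_list_Cons:
  assumes "induced_list R (y # q)" "x \<noteq> y" "x \<notin> set q" "\<And>z. z \<in> set q \<Longrightarrow> \<not> R x z"
  shows "induced_list R (x # y # q)"
  unfolding induced_list_def
proof (intro conjI allI impI)
  show "distinct (x # y # q)" using assms by (auto simp: induced_list_def)
  fix as a vs b bs assume h: "x # y # q = as @ a # vs @ b # bs \<and> R a b"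
  show "vs = []"
  proof (cases as)
    case Nil
    with h have "x = a" "y # q = vs @ b # bs" by auto
    with h assms(4) show ?thesis by (cases vs) auto
  next
    case (Cons c cs)
    with h have "y # q = cs @ a # vs @ b # bs" by auto
    with h assms(1) show ?thesis unfolding induced_list_def by blast
  qed
qed

lemma path_between_rev:
  assumes "path_between R S f g p" and sym: "\<And>x y. x \<in> S \<Longrightarrow> y \<in> S \<Longrightarrow> R x y \<Longrightarrow> R y x"
  shows "path_between R S g f (rev p)"
proof -
  have "successively (\<lambda>x y. R y x) p"
    using assms unfolding path_between_def
    by (auto intro: successively_mono)
  then show ?thesis
    using assms by (auto simp: path_between_def hd_rev last_rev)
qed

text \<open>An inner vertex of an induced path has two neighbours on the path that are not adjacent to each
  other, which a simplicial vertex cannot have.\<close>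

lemma simplicial_vertex_on_induced_path:
  assumes v: "simplicial_vertex R T v" and p: "path_between R T f g p" "induced_list R p"
    and sym: "\<And>x y. x \<in> T \<Longrightarrow> y \<in> T \<Longrightarrow> R x y \<Longrightarrow> R y x"
    and mem: "v \<in> set p"
  shows "v = f \<or> v = g"
proof (rule ccontr)
  assume ends: "\<not> (v = f \<or> v = g)"
  obtain us ws where dec: "p = us @ v # ws" using mem by (auto simp: in_set_conv_decomp)
  have "us \<noteq> []" "ws \<noteq> []" using dec p ends by (auto simp: path_between_def)
  then obtain as x y bs where "us = as @ [x]" "ws = y # bs"
    by (meson rev_exhaust list.exhaust)
  have "distinct p" using p(2) by (simp add: induced_list_def)
  from dec \<open>us = as @ [x]\<close> \<open>ws = y # bs\<close> have dec': "p = as @ x # [v] @ y # bs" by simp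
  have "R x v" "R v y" "x \<in> T" "y \<in> T" "x \<noteq> y"
    using p(1) \<open>distinct p\<close> unfolding dec'
    by (auto simp: path_between_def successively_append_iff)
  then have "R x y" using v sym[of x v] unfolding simplicial_vertex_def by blast
  then show False using p(2) dec' unfolding induced_list_def by blast
qed

text \<open>Let the two paths start at the simplicial vertex \<open>v\<close> with second vertices \<open>x\<close> and \<open>y\<close>, so that
  the rest of both paths avoids \<open>v\<close>. If \<open>x = y\<close> the rests agree by hypothesis. Otherwise \<open>x\<close> and \<open>y\<close>
  are adjacent, and rerouting the second path through \<open>x\<close> instead of \<open>v\<close> leads to an induced path
  avoiding \<open>v\<close>, which must be the rest of the first path; but then \<open>y\<close> is a second neighbour of \<open>v\<close>
  on the first path. The rerouted path has no chord at \<open>x\<close>: a chord to a neighbour of \<open>y\<close> would give a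
  diamond, and a chord to another \<open>z\<close> would give a second induced path \<open>y, x, z\<close> beside the
  segment from \<open>y\<close> to \<open>z\<close>.\<close>

lemma induced_path_unique_step:
  assumes sym: "\<And>x y. x \<in> T \<Longrightarrow> y \<in> T \<Longrightarrow> R x y \<Longrightarrow> R y x"
    and diamond: "\<And>f x y z. \<lbrakk>{f, x, y, z} \<subseteq> T; R f x; R f y; R x y; R x z; R y z; f \<noteq> z\<rbrakk> \<Longrightarrow> R f z"
    and v: "simplicial_vertex R T v"
    and IH: "\<And>f g p q. \<lbrakk>path_between R (T - {v}) f g p; induced_list R p;
        path_between R (T - {v}) f g q; induced_list R q\<rbrakk> \<Longrightarrow> p = q"
    and p: "path_between R T v g p" "induced_list R p"
    and q: "path_between R T v g q" "induced_list R q"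
  shows "p = q"
proof (cases "v = g")
  case True
  have "r = [v]" if r: "path_between R T v g r" "induced_list R r" for r
  proof -
    have "distinct r" using r(2) by (simp add: induced_list_def)
    then show ?thesis
      using r(1) True by (cases r) (auto simp: path_between_def split: if_splits)
  qed
  then show ?thesis using p q by metis
next
  case False
  have "\<exists>x r'. r = v # x # r'" if "path_between R T v g r" for r
    using that False by (cases r rule: remdups_adj.cases) (auto simp: path_between_def)
  then obtain x p' y q' where ps: "p = v # x # p'" and qs: "q = v # y # q'"
    using p q by metis
  have dist: "distinct p" "distinct q" using p(2) q(2) by (simp_all add: induced_list_def)
  have tailp: "path_between R (T - {v}) x g (x # p')" "induced_list R (x # p')"
    using p(1) dist(1) induced_list_factor[of R "[v]" "x # p'" "[]"] p(2) unfolding ps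
    by (auto simp: path_between_def)
  have tailq: "path_between R (T - {v}) y g (y # q')" "induced_list R (y # q')"
    using q(1) dist(2) induced_list_factor[of R "[v]" "y # q'" "[]"] q(2) unfolding qs
    by (auto simp: path_between_def)
  have vx: "R v x" and vy: "R v y"
    using p(1) q(1) unfolding ps qs by (auto simp: path_between_def)
  have no_chord_p: "\<not> R v z" if "z \<in> set p'" for z
  proof
    assume "R v z"
    obtain us ws where "p = [] @ v # (x # us) @ z # ws"
      using \<open>z \<in> set p'\<close> unfolding ps by (auto simp: in_set_conv_decomp)
    with \<open>R v z\<close> p(2) show False unfolding induced_list_def by blast
  qed
  have no_chord_q: "\<not> R v z" if "z \<in> set q'" for z
  proof
    assume "R v z"
    obtain us ws where "q = [] @ v # (y # us) @ z # ws"
      using \<open>z \<in> set q'\<close> unfolding qs by (auto simp: in_set_conv_decomp)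
    with \<open>R v z\<close> q(2) show False unfolding induced_list_def by blast
  qed
  show ?thesis
  proof (cases "x = y")
    case True
    then show ?thesis using IH[OF tailp] tailq ps qs by auto
  next
    case neq: False
    have inT: "v \<in> T" "x \<in> T" "y \<in> T" "set q' \<subseteq> T"
      using p q unfolding ps qs by (auto simp: path_between_def)
    have xy: "R x y" using v vx vy neq inT unfolding simplicial_vertex_def by blast
    have x_notin: "x \<notin> set q'" using no_chord_q vx by auto
    have "\<not> R x z" if z: "z \<in> set q'" for z
    proof
      assume xz: "R x z"
      have "z \<noteq> v" "z \<noteq> y" "z \<in> T"
        using dist(2) z inT unfolding qs by auto
      have yz: "\<not> R y z"
        using diamond[of v x y z] inT \<open>z \<in> T\<close> \<open>z \<noteq> v\<close> vx vy xy xz no_chord_q[OF z] by auto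
      obtain us ws where dec: "q' = us @ z # ws" using z by (auto simp: in_set_conv_decomp)
      have "induced_list R [y, x, z]"
      proof (rule induced_list_Cons)
        show "induced_list R [x, z]"
          using x_notin z by (auto simp: induced_list_def Cons_eq_append_conv)
      qed (use neq yz \<open>z \<noteq> y\<close> in auto)
      moreover have "path_between R (T - {v}) y z [y, x, z]"
        using tailp tailq xy xz sym inT \<open>z \<in> T\<close> \<open>z \<noteq> v\<close> by (auto simp: path_between_def)
      moreover have "induced_list R (y # us @ [z])"
        using induced_list_factor[of R "[]" "y # us @ [z]" ws] tailq(2) dec by simp
      moreover have "path_between R (T - {v}) y z (y # us @ [z])"
      proof -
        have "successively R ((y # us @ [z]) @ ws)"
          using tailq(1) dec by (simp add: path_between_def)
        then have "successively R (y # us @ [z])"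
          by (simp only: successively_append_iff[of R "y # us @ [z]"])
        then show ?thesis using tailq(1) dec by (simp add: path_between_def)
      qed
      ultimately have "[y, x, z] = y # us @ [z]" using IH by blast
      then have "x \<in> set q'" using dec by (cases us) auto
      with x_notin show False by simp
    qed
    then have "induced_list R (x # y # q')"
      using tailq(2) neq x_notin by (intro induced_list_Cons) auto
    moreover have "path_between R (T - {v}) x g (x # y # q')"
      using tailp tailq xy by (auto simp: path_between_def)
    ultimately have "x # p' = x # y # q'" using IH[OF tailp] by blast
    then have "y \<in> set p'" by simp
    with no_chord_p vy show ?thesis by blast
  qed
qed

text \<open>A simplicial vertex that lies on one of the two paths is an end of both, so it is either avoided
  altogether or, up to reversal, the common start.\<close>

lemma induced_path_unique:
  assumes "finite S"
    and sym: "\<And>x y. x \<in> S \<Longrightarrow> y \<in> S \<Longrightarrow> R x y \<Longrightarrow> R y x"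
    and diamond: "\<And>f x y z. \<lbrakk>{f, x, y, z} \<subseteq> S; R f x; R f y; R x y; R x z; R y z; f \<noteq> z\<rbrakk> \<Longrightarrow> R f z"
    and simplicial: "\<And>T. T \<subseteq> S \<Longrightarrow> T \<noteq> {} \<Longrightarrow> \<exists>v. simplicial_vertex R T v"
    and "path_between R S f g p" "induced_list R p" "path_between R S f g q" "induced_list R q"
  shows "p = q"
  using assms
proof (induction S arbitrary: f g p q rule: finite_psubset_induct)
  case (psubset T)
  note sym = psubset.prems(1) and diamond = psubset.prems(2)
    and p = psubset.prems(4,5) and q = psubset.prems(6,7)
  have "T \<noteq> {}" using p by (auto simp: path_between_def)
  then obtain v where v: "simplicial_vertex R T v" using psubset.prems(3) by blast
  have "T - {v} \<subset> T" using v by (auto simp: simplicial_vertex_def)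
  have IH: "p = q" if "path_between R (T - {v}) f g p" "induced_list R p"
    "path_between R (T - {v}) f g q" "induced_list R q" for f g p q
  proof (rule psubset.IH[OF \<open>T - {v} \<subset> T\<close> _ _ _ that])
    show "R y x" if "x \<in> T - {v}" "y \<in> T - {v}" "R x y" for x y
      using that sym by blast
    show "R f z" if "{f, x, y, z} \<subseteq> T - {v}" "R f x" "R f y" "R x y" "R x z" "R y z" "f \<noteq> z"
      for f x y z
      using that diamond[of f x y z] by blast
    show "\<exists>v. simplicial_vertex R U v" if "U \<subseteq> T - {v}" "U \<noteq> {}" for U
      using that psubset.prems(3)[of U] by blast
  qed
  have step: "p = q" if "path_between R T v g p" "induced_list R p"
    "path_between R T v g q" "induced_list R q" for g p q
    by (rule induced_path_unique_step[OF sym diamond v IH that])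
  consider "v = f" | "v = g" | "v \<noteq> f" "v \<noteq> g" by blast
  then show "p = q"
  proof cases
    case 1
    then show ?thesis using step[of g p q] p q by simp
  next
    case 2
    have rev: "path_between R T v f (rev r)" "induced_list R (rev r)"
      if r: "path_between R T f g r" "induced_list R r" for r
    proof -
      show "path_between R T v f (rev r)" using path_between_rev[OF r(1) sym] 2 by simp
      have "set r \<subseteq> T" using r(1) by (simp add: path_between_def)
      then show "induced_list R (rev r)" using r(2) sym by (intro induced_list_rev) blast+
    qed
    have "rev p = rev q" by (rule step[OF rev[OF p] rev[OF q]])
    then show ?thesis by simp
  next
    case 3
    have avoid: "path_between R (T - {v}) f g r"
      if r: "path_between R T f g r" "induced_list R r" for r
      using simplicial_vertex_on_induced_path[OF v r sym] r(1) 3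
      by (auto simp: path_between_def)
    show ?thesis by (rule IH[OF avoid[OF p] p(2) avoid[OF q] q(2)])
  qed
qed

section \<open>Facets of a simplicial tree\<close>

definition codim1_adjacent :: "'a set \<Rightarrow> 'a set \<Rightarrow> bool" where
  "codim1_adjacent A B \<longleftrightarrow> face_dim (A \<inter> B) = face_dim B - 1"

lemma proper_chain_iff_path_between:
  "proper_chain \<Delta> F G ch \<longleftrightarrow> path_between codim1_adjacent (facets \<Delta>) F G ch"
  by (simp add: proper_chain_def path_between_def codim1_adjacent_def)

text \<open>A repeated facet or a chord would allow a shortcut, which is a proper subsequence.\<close>

lemma irredundant_proper_chain_induced:
  assumes "irredundant_proper_chain \<Delta> F G p"
  shows "induced_list codim1_adjacent p"
proof -
  have p: "path_between codim1_adjacent (facets \<Delta>) F G p"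
    and min: "\<And>q. subseq q p \<Longrightarrow> path_between codim1_adjacent (facets \<Delta>) F G q \<Longrightarrow> q = p"
    using assms by (auto simp: irredundant_proper_chain_def proper_chain_iff_path_between)
  have "distinct p"
  proof (rule ccontr)
    assume "\<not> distinct p"
    then obtain us x vs ws where dec: "p = us @ [x] @ vs @ [x] @ ws"
      using not_distinct_decomp by blast
    have "path_between codim1_adjacent (facets \<Delta>) F G (us @ [x] @ ws)"
      using p unfolding dec path_between_def
      by (auto simp: successively_append_iff successively_Cons hd_append split: if_splits)
    moreover have "subseq (us @ [x] @ ws) p"
      unfolding dec by (metis append_assoc list_emb_append_mono list_emb_append2 subseq_order.refl)
    ultimately have "us @ [x] @ ws = p" by (rule min[rotated])
    then show False unfolding dec by simp
  qed
  moreover have "vs = []" if dec: "p = us @ x # vs @ y # ws" and xy: "codim1_adjacent x y"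
    for us x vs y ws
  proof -
    have "path_between codim1_adjacent (facets \<Delta>) F G (us @ x # y # ws)"
      using p xy unfolding dec path_between_def
      by (auto simp: successively_append_iff successively_Cons hd_append split: if_splits)
    moreover have "subseq (us @ x # y # ws) p"
      unfolding dec by (simp add: subseq_append' list_emb_append2)
    ultimately have "us @ x # y # ws = p" by (rule min[rotated])
    then show ?thesis unfolding dec by simp
  qed
  ultimately show ?thesis unfolding induced_list_def by blast
qed

lemma proper_chain_contains_irredundant:
  assumes "proper_chain \<Delta> F G ch"
  obtains p where "subseq p ch" "irredundant_proper_chain \<Delta> F G p"
proof -
  let ?P = "\<lambda>q. subseq q ch \<and> proper_chain \<Delta> F G q"
  obtain p where p: "?P p" and least: "\<And>q. ?P q \<Longrightarrow> length p \<le> length q"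
    using ex_has_least_nat[of ?P ch length] assms by auto
  have "q = p" if "subseq q p" "proper_chain \<Delta> F G q" for q
  proof -
    have "length p \<le> length q" using that p least subseq_order.order_trans by blast
    then show ?thesis
      using that(1) list_emb_length[OF that(1)] subseq_same_length by fastforce
  qed
  then show ?thesis using that p unfolding irredundant_proper_chain_def by blast
qed

text \<open>Facets form an antichain, so every set of facets is the facet set of the complex that it
  generates. Thus subcollections amount to sets of facets.\<close>

lemma facets_of_generated_complex:
  assumes "T \<subseteq> facets \<Delta>"
  shows "facets {X. \<exists>F\<in>T. X \<subseteq> F} = T"
proof -
  have antichain: "G = F" if "F \<in> T" "G \<in> T" "F \<subseteq> G" for F G
    using assms that unfolding facets_def by blast
  show ?thesis
  proof
    show "facets {X. \<exists>F\<in>T. X \<subseteq> F} \<subseteq> T" unfolding facets_def by blast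
    show "T \<subseteq> facets {X. \<exists>F\<in>T. X \<subseteq> F}"
    proof
      fix F assume F: "F \<in> T"
      have "X = F" if "F \<subseteq> X" "G \<in> T" "X \<subseteq> G" for X G
        using antichain[OF F \<open>G \<in> T\<close>] that by blast
      with F show "F \<in> facets {X. \<exists>F\<in>T. X \<subseteq> F}" unfolding facets_def by blast
    qed
  qed
qed

lemma simplicial_tree_leaf:
  assumes tree: "simplicial_tree \<Delta>" and T: "T \<subseteq> facets \<Delta>" "T \<noteq> {}"
  obtains F where "F \<in> T"
    "T = {F} \<or> (\<exists>G\<in>T. G \<noteq> F \<and> (\<forall>H\<in>T. H \<noteq> F \<longrightarrow> H \<inter> F \<subseteq> G \<inter> F))"
proof -
  let ?\<Gamma> = "{X. \<exists>F\<in>T. X \<subseteq> F}"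
  have "finite (\<Union>\<Delta>)" using tree by (auto simp: simplicial_tree_def simplicial_complex_def)
  moreover have "\<Union>?\<Gamma> \<subseteq> \<Union>\<Delta>" using T by (auto simp: facets_def)
  ultimately have "finite (\<Union>?\<Gamma>)" by (rule rev_finite_subset)
  then have "simplicial_complex ?\<Gamma>" using T(2) unfolding simplicial_complex_def by auto
  then have "subcollection ?\<Gamma> \<Delta>"
    using T facets_of_generated_complex[OF T(1)] by (simp add: subcollection_def)
  then obtain F where "leaf ?\<Gamma> F" using tree unfolding simplicial_tree_def by blast
  then show ?thesis using that unfolding leaf_def facets_of_generated_complex[OF T(1)] by blast
qed

text \<open>A face of maximal dimension is a facet, and purity transfers its dimension to all others.\<close>

lemma facet_dim_eq_complex_dim:
  assumes sc: "simplicial_complex \<Delta>" and pure: "pure_complex \<Delta>" and F: "F \<in> facets \<Delta>"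
  shows "face_dim F = complex_dim \<Delta>"
proof -
  have fin: "finite \<Delta>" using sc finite_UnionD by (auto simp: simplicial_complex_def)
  have fin_face: "finite X" if "X \<in> \<Delta>" for X
    using sc that by (meson Union_upper finite_subset simplicial_complex_def)
  have "complex_dim \<Delta> \<in> face_dim ` \<Delta>" unfolding complex_dim_def
    using fin sc by (intro Max_in) (auto simp: simplicial_complex_def)
  then obtain G where G: "G \<in> \<Delta>" "face_dim G = complex_dim \<Delta>" by auto
  have "G \<in> facets \<Delta>" unfolding facets_def
  proof (intro CollectI conjI ballI impI G)
    fix H assume H: "H \<in> \<Delta>" "G \<subseteq> H"
    have "face_dim H \<le> face_dim G"
      using H fin G(2) unfolding complex_dim_def by (auto intro: Max_ge)
    then show "H = G" using card_seteq[OF fin_face[OF H(1)] H(2)] by (simp add: face_dim_def)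
  qed
  then have "face_dim F = face_dim G" using pure F unfolding pure_complex_def by blast
  then show ?thesis using G(2) by simp
qed

locale pure_simplicial_tree =
  fixes \<Delta> :: "'a set set" and n :: nat
  assumes tree: "simplicial_tree \<Delta>"
    and facet_card: "F \<in> facets \<Delta> \<Longrightarrow> finite F \<and> card F = n"
begin

lemma codim1_adjacent_iff:
  assumes "F \<in> facets \<Delta>" "G \<in> facets \<Delta>"
  shows "codim1_adjacent F G \<longleftrightarrow> Suc (card (F \<inter> G)) = n"
  using facet_card[OF assms(1)] facet_card[OF assms(2)]
  by (auto simp: codim1_adjacent_def face_dim_def)

lemma adjacent_sym:
  assumes "F \<in> facets \<Delta>" "G \<in> facets \<Delta>" "codim1_adjacent F G"
  shows "codim1_adjacent G F"
  using assms by (simp add: codim1_adjacent_iff Int_commute)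

lemma facets_eq_of_subset:
  assumes "F \<in> facets \<Delta>" "G \<in> facets \<Delta>" "F \<subseteq> G"
  shows "F = G"
  using assms by (auto simp: facets_def)

lemma adjacent_if_common_ridge:
  assumes FG: "F \<in> facets \<Delta>" "G \<in> facets \<Delta>" "F \<noteq> G" and E: "E \<subseteq> F" "E \<subseteq> G" "Suc (card E) = n"
  shows "codim1_adjacent F G"
proof -
  have fin: "finite F" "card F = n" using facet_card FG by auto
  have "card (F \<inter> G) < n"
    using facets_eq_of_subset[OF FG(1,2)] FG(3) fin psubset_card_mono[of F "F \<inter> G"] by auto
  moreover have "card E \<le> card (F \<inter> G)" using E fin by (intro card_mono) auto
  ultimately show ?thesis using E FG by (simp add: codim1_adjacent_iff)
qed

text \<open>In a leaf \<open>F\<close>, witnessed by \<open>G\<close>, all the intersections with adjacent facets equal \<open>G \<inter> F\<close>: they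
  are contained in it and already have the largest size possible.\<close>

lemma ridge_in_leaf:
  assumes FX: "F \<in> facets \<Delta>" "G \<in> facets \<Delta>" "X \<in> facets \<Delta>" "G \<noteq> F"
    and adj: "codim1_adjacent F X" and sub: "X \<inter> F \<subseteq> G \<inter> F"
  shows "X \<inter> F = G \<inter> F"
proof -
  have fin: "finite F" "card F = n" using facet_card FX by auto
  have "card (G \<inter> F) < n"
    using facets_eq_of_subset[OF FX(1,2)] FX(4) fin psubset_card_mono[of F "G \<inter> F"] by auto
  moreover have "Suc (card (X \<inter> F)) = n"
    using adj FX codim1_adjacent_iff by (simp add: Int_commute)
  ultimately show ?thesis using sub fin by (intro card_seteq) auto
qed

text \<open>The neighbours of a leaf all contain the same ridge, hence are adjacent to each other.\<close>

lemma leaf_simplicial: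
  assumes T: "T \<subseteq> facets \<Delta>" "T \<noteq> {}"
  shows "\<exists>F. simplicial_vertex codim1_adjacent T F"
proof -
  obtain F where F: "F \<in> T"
    "T = {F} \<or> (\<exists>G\<in>T. G \<noteq> F \<and> (\<forall>H\<in>T. H \<noteq> F \<longrightarrow> H \<inter> F \<subseteq> G \<inter> F))"
    using simplicial_tree_leaf[OF tree T] .
  have "codim1_adjacent X Y"
    if XY: "X \<in> T" "Y \<in> T" "codim1_adjacent F X" "codim1_adjacent F Y" "X \<noteq> Y" for X Y
  proof -
    have irr: "\<not> codim1_adjacent F F" by (simp add: codim1_adjacent_def)
    with XY have ne: "X \<noteq> F" "Y \<noteq> F" by auto
    with F XY obtain G where G: "G \<in> T" "G \<noteq> F" "\<forall>H\<in>T. H \<noteq> F \<longrightarrow> H \<inter> F \<subseteq> G \<inter> F"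
      by auto
    have "H \<inter> F = G \<inter> F" if "H \<in> T" "codim1_adjacent F H" "H \<noteq> F" for H
      using that G F(1) T(1) by (intro ridge_in_leaf) auto
    then have "X \<inter> F = G \<inter> F" "Y \<inter> F = G \<inter> F" using XY ne by blast+
    then show ?thesis
      using adjacent_if_common_ridge[of X Y "X \<inter> F"] XY T F
      by (auto simp: codim1_adjacent_iff Int_commute subset_iff)
  qed
  then show ?thesis using F(1) unfolding simplicial_vertex_def by blast
qed

text \<open>One of the three facets is a leaf of the complex that they generate, so its ridges with the two
  others coincide.\<close>

lemma triangle_common_ridge:
  assumes XYZ: "X \<in> facets \<Delta>" "Y \<in> facets \<Delta>" "Z \<in> facets \<Delta>"
    and adj: "codim1_adjacent X Y" "codim1_adjacent X Z" "codim1_adjacent Y Z"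
  shows "X \<inter> Y \<subseteq> Z"
proof -
  have ne: "X \<noteq> Y" "X \<noteq> Z" "Y \<noteq> Z" using adj by (auto simp: codim1_adjacent_def)
  have adj': "codim1_adjacent Y X" "codim1_adjacent Z X" "codim1_adjacent Z Y"
    using adj XYZ adjacent_sym by blast+
  obtain F where F: "F \<in> {X, Y, Z}"
    "{X, Y, Z} = {F} \<or>
      (\<exists>G\<in>{X, Y, Z}. G \<noteq> F \<and> (\<forall>H\<in>{X, Y, Z}. H \<noteq> F \<longrightarrow> H \<inter> F \<subseteq> G \<inter> F))"
    using simplicial_tree_leaf[OF tree, of "{X, Y, Z}"] XYZ by auto
  then obtain G where G: "G \<in> {X, Y, Z}" "G \<noteq> F"
    "\<forall>H\<in>{X, Y, Z}. H \<noteq> F \<longrightarrow> H \<inter> F \<subseteq> G \<inter> F"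
    using ne by auto
  have eq: "H \<inter> F = G \<inter> F" if "H \<in> {X, Y, Z}" "H \<noteq> F" for H
    using ridge_in_leaf[of F G H] that F(1) G XYZ adj adj' by auto
  consider "F = X" | "F = Y" | "F = Z" using F(1) by auto
  then show ?thesis
  proof cases
    case 3
    \<comment> \<open>The leaf is \<open>Z\<close>, of which \<open>X \<inter> Y\<close> is not a ridge a priori; comparing sizes shows that it is.\<close>
    have "X \<inter> Z = Y \<inter> Z" using eq[of X] eq[of Y] ne 3 by auto
    then have "X \<inter> Z \<subseteq> X \<inter> Y" by auto
    moreover have "card (X \<inter> Z) = card (X \<inter> Y)"
      using adj XYZ codim1_adjacent_iff by (metis nat.inject)
    moreover have "finite (X \<inter> Y)" using facet_card XYZ by auto
    ultimately have "X \<inter> Z = X \<inter> Y" by (metis card_subset_eq)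
    then show ?thesis by auto
  next
    case 1
    with eq[of Y] eq[of Z] ne show ?thesis by auto
  next
    case 2
    with eq[of X] eq[of Z] ne show ?thesis by auto
  qed
qed

text \<open>The two triangles share the ridge \<open>X \<inter> Y\<close>, so it lies in both \<open>F\<close> and \<open>Z\<close>.\<close>

lemma adjacent_diamond:
  assumes "{F, X, Y, Z} \<subseteq> facets \<Delta>" "codim1_adjacent F X" "codim1_adjacent F Y"
    "codim1_adjacent X Y" "codim1_adjacent X Z" "codim1_adjacent Y Z" "F \<noteq> Z"
  shows "codim1_adjacent F Z"
proof (rule adjacent_if_common_ridge)
  show "X \<inter> Y \<subseteq> F"
    using triangle_common_ridge[of X Y F] assms adjacent_sym by auto
  show "X \<inter> Y \<subseteq> Z"
    using triangle_common_ridge[of X Y Z] assms by auto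
  show "Suc (card (X \<inter> Y)) = n"
    using assms codim1_adjacent_iff by auto
qed (use assms in auto)

lemma irredundant_proper_chain_unique:
  assumes "irredundant_proper_chain \<Delta> F G p" "irredundant_proper_chain \<Delta> F G q"
  shows "p = q"
proof (rule induced_path_unique)
  show "finite (facets \<Delta>)"
    using tree by (auto simp: facets_def simplicial_tree_def simplicial_complex_def
        intro: finite_subset dest: finite_UnionD)
  show "path_between codim1_adjacent (facets \<Delta>) F G p"
    "path_between codim1_adjacent (facets \<Delta>) F G q"
    using assms by (auto simp: irredundant_proper_chain_def proper_chain_iff_path_between)
  show "induced_list codim1_adjacent p" "induced_list codim1_adjacent q"
    using assms irredundant_proper_chain_induced by blast+
qed (fact adjacent_sym adjacent_diamond leaf_simplicial)+

lemma facet_dist_eq: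
  assumes "irredundant_proper_chain \<Delta> F G p"
  shows "facet_dist \<Delta> F G = length p - 1"
proof -
  have "(THE ch. irredundant_proper_chain \<Delta> F G ch) = p"
    using assms irredundant_proper_chain_unique by blast
  then show ?thesis by (simp add: facet_dist_def)
qed

text \<open>Every facet after the first contributes at most one new vertex.\<close>

lemma card_Union_chain:
  assumes "p \<noteq> []" "set p \<subseteq> facets \<Delta>" "successively codim1_adjacent p"
  shows "card (\<Union>(set p)) < n + length p"
  using assms
proof (induction p rule: induct_list012)
  case (2 F)
  then show ?case using facet_card by auto
next
  case (3 F G p)
  let ?U = "\<Union>(set (G # p))"
  have fin: "finite ?U" using 3(4) facet_card by auto
  have F: "finite F" "card F = n" using 3(4) facet_card by auto
  have "Suc (card (F \<inter> G)) = n" using 3(4,5) codim1_adjacent_iff[of F G] by auto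
  then have "card (F - G) = 1"
    using card_Diff_subset_Int[of F G] F by simp
  then have "card (F - ?U) \<le> 1"
    using card_mono[of "F - G" "F - ?U"] F by auto
  then have "card (F \<union> ?U) \<le> Suc (card ?U)"
    using card_Un_disjoint[of "F - ?U" ?U] fin F by (simp add: Un_Diff_cancel2 Int_commute)
  moreover have "card ?U < n + length (G # p)"
    using 3 by auto
  ultimately show ?case by simp
qed simp

text \<open>The vertex count leaves no room for a vertex outside the two disjoint ends.\<close>

lemma short_chain_within_union:
  assumes AB: "A \<in> facets \<Delta>" "B \<in> facets \<Delta>" "disjnt A B"
    and p: "proper_chain \<Delta> A B p" "length p = Suc n" and X: "X \<in> set p"
  shows "X \<subseteq> A \<union> B"
proof -
  have pb: "p \<noteq> []" "set p \<subseteq> facets \<Delta>" "successively codim1_adjacent p" "hd p = A" "last p = B"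
    using p by (auto simp: proper_chain_iff_path_between path_between_def)
  have "finite (\<Union>(set p))" using pb facet_card by auto
  moreover have "A \<union> B \<subseteq> \<Union>(set p)" using pb hd_in_set last_in_set by fastforce
  moreover have "card (A \<union> B) = 2 * n"
    using AB facet_card[OF AB(1)] facet_card[OF AB(2)] card_Un_disjoint[of A B]
    by (simp add: disjnt_def)
  ultimately have "A \<union> B = \<Union>(set p)"
    using card_Union_chain[OF pb(1-3)] p(2) by (intro card_seteq) auto
  then show ?thesis using X by auto
qed

lemma proper_chain_append:
  assumes "proper_chain \<Delta> A C q" "proper_chain \<Delta> C B r"
  shows "proper_chain \<Delta> A B (q @ tl r)"
proof (cases r)
  case Nil
  then show ?thesis using assms by (simp add: proper_chain_def)
next
  case (Cons c r')
  moreover have "c = C" using Cons assms(2) by (simp add: proper_chain_def)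
  ultimately show ?thesis using assms
    by (cases "r' = []") (simp_all add: proper_chain_def successively_append_iff successively_Cons)
qed

end

section \<open>The matching number\<close>

text \<open>By uniqueness, a detour through \<open>C\<close> contains the chain from \<open>A\<close> to \<open>B\<close>. The second member \<open>X\<close> of
  that chain would then lie in two of the unions \<open>A \<union> B\<close>, \<open>A \<union> C\<close>, \<open>B \<union> C\<close>, hence in \<open>A\<close> or \<open>B\<close>.\<close>

lemma no_three_disjoint_facets:
  assumes ip: "intersection_property \<Delta>" and dim: "complex_dim \<Delta> \<ge> 1"
    and facets: "A \<in> facets \<Delta>" "B \<in> facets \<Delta>" "C \<in> facets \<Delta>"
    and disj: "disjnt A B" "disjnt A C" "disjnt B C"
  shows False
proof -
  define n where "n = nat (complex_dim \<Delta> + 1)"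
  have tree: "simplicial_tree \<Delta>" and pure: "pure_complex \<Delta>" and conn: "connected_in_codim_1 \<Delta>"
    using ip by (auto simp: intersection_property_def)
  have sc: "simplicial_complex \<Delta>" using tree by (simp add: simplicial_tree_def)
  have n: "int n = complex_dim \<Delta> + 1" "n \<ge> 2" using dim by (auto simp: n_def)
  interpret pure_simplicial_tree \<Delta> n
  proof
    show "finite F \<and> card F = n" if "F \<in> facets \<Delta>" for F
    proof
      show "card F = n"
        using facet_dim_eq_complex_dim[OF sc pure that] n by (simp add: face_dim_def)
      then show "finite F" using n by (metis card.infinite not_numeral_le_zero)
    qed
  qed (fact tree)
  have chain: "\<exists>p. irredundant_proper_chain \<Delta> F G p \<and> proper_chain \<Delta> F G p \<and> length p = Suc n"
    if FG: "F \<in> facets \<Delta>" "G \<in> facets \<Delta>" "disjnt F G" for F G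
  proof -
    have "face_dim F \<ge> face_dim G" 
      using facet_dim_eq_complex_dim[OF sc pure] FG(1,2) by simp
    then obtain ch where "proper_chain \<Delta> F G ch"
      using conn FG unfolding connected_in_codim_1_def by blast
    then obtain p where p: "irredundant_proper_chain \<Delta> F G p"
      by (rule proper_chain_contains_irredundant)
    have "face_dim (F \<inter> G) = complex_dim \<Delta> - int n"
      using FG(3) n by (simp add: face_dim_def disjnt_def)
    then have "int (facet_dist \<Delta> F G) = int n"
      using ip FG n unfolding intersection_property_def by auto
    then have "length p - 1 = n" using facet_dist_eq[OF p] by simp
    then show ?thesis using p n by (auto simp: irredundant_proper_chain_def)
  qed
  obtain p where p: "irredundant_proper_chain \<Delta> A B p" "proper_chain \<Delta> A B p" "length p = Suc n"
    using chain[of A B] facets disj by auto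
  obtain q where q: "proper_chain \<Delta> A C q" "length q = Suc n"
    using chain[of A C] facets disj by auto
  have CB: "disjnt C B" using disj by (simp add: disjnt_sym)
  obtain r where r: "proper_chain \<Delta> C B r" "length r = Suc n"
    using chain[of C B] facets CB by auto
  obtain s where "subseq s (q @ tl r)" "irredundant_proper_chain \<Delta> A B s"
    using proper_chain_contains_irredundant[OF proper_chain_append[OF q(1) r(1)]] .
  then have "subseq p (q @ tl r)" using irredundant_proper_chain_unique p(1) by blast
  then have "set p \<subseteq> set (q @ tl r)" by (auto elim: list_emb_set)
  moreover have "set (tl r) \<subseteq> set r" by (cases r) auto
  ultimately have sub: "set p \<subseteq> set q \<union> set r" by auto
  have "\<exists>X ys. p = A # X # ys \<and> ys \<noteq> [] \<and> last ys = B"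
    using p(2,3) n(2) by (cases p rule: remdups_adj.cases) (auto simp: proper_chain_def split: if_splits)
  then obtain X ys where ps: "p = A # X # ys" "ys \<noteq> []" "last ys = B" by auto
  have "distinct p" using irredundant_proper_chain_induced[OF p(1)] by (simp add: induced_list_def)
  with ps have ne: "X \<noteq> A" "X \<noteq> B" using last_in_set[of ys] by auto
  have X: "X \<in> set p" "X \<in> facets \<Delta>" using p(2) unfolding ps by (auto simp: proper_chain_def)
  have XAB: "X \<subseteq> A \<union> B"
    using short_chain_within_union[OF facets(1,2) disj(1) p(2,3)] X by simp
  have "X \<in> set q \<or> X \<in> set r" using X sub by auto
  then show False
  proof
    assume "X \<in> set q"
    then have "X \<subseteq> A \<union> C"
      by (rule short_chain_within_union[OF facets(1,3) disj(2) q])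
    with XAB have "X \<subseteq> A" using disj by (auto simp: disjnt_iff)
    then show False using facets_eq_of_subset X facets ne by blast
  next
    assume "X \<in> set r"
    then have "X \<subseteq> C \<union> B"
      by (rule short_chain_within_union[OF facets(3,2) CB r])
    with XAB have "X \<subseteq> B" using disj by (auto simp: disjnt_iff)
    then show False using facets_eq_of_subset X facets ne by blast
  qed
qed

theorem proposition2p1:
  fixes \<Delta> :: "'a set set"
  assumes "simplicial_tree \<Delta>"
    and "intersection_property \<Delta>"
    and "complex_dim \<Delta> \<ge> 1"
  shows "matching_number \<Delta> \<le> 2"
proof -
  have "finite \<Delta>"
    using assms(1) finite_UnionD by (auto simp: simplicial_tree_def simplicial_complex_def)
  then have fin: "finite (facets \<Delta>)" by (simp add: facets_def)
  have "{M. matching \<Delta> M} \<subseteq> Pow (facets \<Delta>)" by (auto simp: matching_def)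
  then have "finite {M. matching \<Delta> M}" using fin finite_subset by blast
  moreover have "{} \<in> {M. matching \<Delta> M}" by (simp add: matching_def)
  moreover have "card M \<le> 2" if M: "matching \<Delta> M" for M
  proof (rule ccontr)
    assume "\<not> card M \<le> 2"
    then have "3 \<le> card M" by simp
    then obtain M' where M': "M' \<subseteq> M" "card M' = 3" by (meson obtain_subset_with_card_n)
    then obtain A B C where ABC: "M' = {A, B, C}" "A \<noteq> B" "A \<noteq> C" "B \<noteq> C"
      by (auto simp: card_3_iff)
    then have "A \<in> facets \<Delta>" "B \<in> facets \<Delta>" "C \<in> facets \<Delta>"
      "disjnt A B" "disjnt A C" "disjnt B C"
      using M M' by (auto simp: matching_def pairwise_def)
    then show False by (rule no_three_disjoint_facets[OF assms(2,3)])
  qed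
  ultimately show ?thesis unfolding matching_number_def by (subst Max_le_iff) auto
qed

end
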